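(* If $T\subseteq\mathbb{Z}^n$ is an integer tiling with $\Upsilon_n$, where $n$ is odd, then $n=2^t-1$ for some $t>0$.
   Context: $\Upsilon_n=\{U\in\mathbb{Z}^n:\sum_i|x_i-u_i|\le1\text{ for some }X\in\{-1,0\}^n\}$. A set $T\subseteq\mathbb{Z}^n$ is an integer tiling with $\Upsilon_n$ if the translates $X+\Upsilon_n$, $X\in T$, partition $\mathbb{Z}^n$. *)

theory Defs
  imports "HOL-Analysis.Finite_Cartesian_Product" "HOL-Library.Disjoint_Sets"
begin

definition Upsilon :: "(int ^ 'n::finite) set" where
  "Upsilon = {U. \<exists>X. (\<forall>i. X $ i \<in> {-1, 0}) \<and> (\<Sum>i\<in>UNIV. \<bar>X $ i - U $ i\<bar>) \<le> 1}"

definition translate :: "int ^ 'n::finite \<Rightarrow> (int ^ 'n) set \<Rightarrow> (int ^ 'n) set" where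
  "translate X S = (\<lambda>Y. X + Y) ` S"

text \<open>Disjointness is that of the family indexed by \<open>T\<close>: translates at distinct
  points of \<open>T\<close> are disjoint.\<close>

definition integer_tiling :: "(int ^ 'n::finite) set \<Rightarrow> (int ^ 'n) set \<Rightarrow> bool" where
  "integer_tiling T S \<longleftrightarrow>
     disjoint_family_on (\<lambda>X. translate X S) T \<and> (\<Union>X\<in>T. translate X S) = UNIV"

end

(* Seen from one of the 2^n corners of the core X + {-1,0}^n of a tile, with coordinates oriented
   outwards, the point two steps out in direction i is covered either by the tile X + 4 e_i or
   by a tile at offset 3 in direction i and 2 in a further direction k ("side"). The points one
   step out in two directions i, k lie in the arm of a tile of type side (i to k or k to i) or of a
   tile at offset (2,2,2) in directions i, k, l. For odd n, counting the pairs containing i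
   modulo 2 shows that each i with a side tile is itself the target k of a side tile, so the partial
   map i -> k is a permutation of its domain. Together with a descent over faces of the cube of
   corners this excludes side tiles. So T is invariant under 4 Z^n, and counting points
   modulo 4 gives that (n + 1) 2^n divides 4^n. *)

theory Submission
  imports Defs "HOL-Computational_Algebra.Primes" "HOL-Library.FuncSet"
begin

section \<open>The tile in coordinates\<close>

text \<open>Integer distance at most 1 from the core lets at most one coordinate leave
  \<open>{-1, 0}\<close>, and by a single step; \<open>j\<close> is the direction of the
  arm.\<close>

lemma mem_Upsilon_iff:
  "U \<in> (Upsilon :: (int ^ 'n::finite) set) \<longleftrightarrow>
     (\<exists>j. U $ j \<in> {-2..1} \<and> (\<forall>m. m \<noteq> j \<longrightarrow> U $ m \<in> {-1, 0}))"
proof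
  assume "U \<in> Upsilon"
  then obtain X where X: "\<And>i. X $ i \<in> {-1, 0}" and s: "(\<Sum>i\<in>UNIV. \<bar>X $ i - U $ i\<bar>) \<le> 1"
    unfolding Upsilon_def by blast
  show "\<exists>j. U $ j \<in> {-2..1} \<and> (\<forall>m. m \<noteq> j \<longrightarrow> U $ m \<in> {-1, 0})"
  proof (cases "U = X")
    case True
    have "U $ m \<in> {-2..1}" for m using X[of m] True by auto
    then show ?thesis using X True by blast
  next
    case False
    then obtain j where j: "X $ j \<noteq> U $ j" by (metis vec_eq_iff)
    have sum_j: "(\<Sum>i\<in>UNIV. \<bar>X $ i - U $ i\<bar>) =
        \<bar>X $ j - U $ j\<bar> + (\<Sum>i\<in>UNIV - {j}. \<bar>X $ i - U $ i\<bar>)"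
      by (simp add: sum.remove)
    have nonneg: "(\<Sum>i\<in>UNIV - {j}. \<bar>X $ i - U $ i\<bar>) \<ge> 0" by (simp add: sum_nonneg)
    have "\<bar>X $ j - U $ j\<bar> \<le> 1" using sum_j nonneg s by linarith
    then have 1: "U $ j \<in> {-2..1}" using X[of j] by auto
    have 2: "U $ m \<in> {-1, 0}" if "m \<noteq> j" for m
    proof -
      have "\<bar>X $ m - U $ m\<bar> \<le> (\<Sum>i\<in>UNIV - {j}. \<bar>X $ i - U $ i\<bar>)"
        using that by (intro member_le_sum) auto
      then have "X $ m = U $ m" using sum_j s j by linarith
      then show ?thesis using X[of m] by simp
    qed
    show ?thesis using 1 2 by blast
  qed
next
  assume "\<exists>j. U $ j \<in> {-2..1} \<and> (\<forall>m. m \<noteq> j \<longrightarrow> U $ m \<in> {-1, 0})"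
  then obtain j where j: "U $ j \<in> {-2..1}" and U: "\<And>m. m \<noteq> j \<Longrightarrow> U $ m \<in> {-1, 0}" by blast
  define X :: "int ^ 'n" where "X = (\<chi> m. if m = j then max (-1) (min 0 (U $ j)) else U $ m)"
  have "(\<Sum>i\<in>UNIV. \<bar>X $ i - U $ i\<bar>) = \<bar>X $ j - U $ j\<bar> + (\<Sum>i\<in>UNIV - {j}. \<bar>X $ i - U $ i\<bar>)"
    by (simp add: sum.remove)
  also have "(\<Sum>i\<in>UNIV - {j}. \<bar>X $ i - U $ i\<bar>) = 0" by (simp add: X_def)
  also have "\<bar>X $ j - U $ j\<bar> + 0 \<le> 1" using j by (auto simp: X_def)
  finally have "(\<Sum>i\<in>UNIV. \<bar>X $ i - U $ i\<bar>) \<le> 1" .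
  moreover have "X $ i \<in> {-1, 0}" for i using U[of i] by (auto simp: X_def)
  ultimately show "U \<in> Upsilon" unfolding Upsilon_def by blast
qed

text \<open>The orbits \<open>{x, f x}\<close> partition \<open>A\<close> into two-element
  sets.\<close>

lemma even_card_fixpoint_free_involution:
  assumes "finite A" and f: "\<And>x. x \<in> A \<Longrightarrow> f x \<in> A \<and> f x \<noteq> x \<and> f (f x) = x"
  shows "even (card A)"
proof -
  let ?P = "(\<lambda>x. {x, f x}) ` A"
  have U: "\<Union>?P = A" using f by auto
  have "2 * card ?P = card (\<Union>?P)"
  proof (rule card_partition)
    show "finite ?P" "finite (\<Union>?P)" using assms(1) U by simp_all
    show "card c = 2" if "c \<in> ?P" for c
    proof -
      obtain x where "x \<in> A" "c = {x, f x}" using \<open>c \<in> ?P\<close> by blast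
      then show ?thesis using f[of x] by (auto simp: card_insert_if)
    qed
    show "c \<inter> d = {}" if cd: "c \<in> ?P" "d \<in> ?P" "c \<noteq> d" for c d
    proof -
      obtain x y where xy: "x \<in> A" "y \<in> A" "c = {x, f x}" "d = {y, f y}" using cd by auto
      have orbit: "{w, f w} = {z, f z}" if "w \<in> A" "z \<in> {w, f w}" for w z
        using f[OF that(1)] that(2) by auto
      have "c = d" if "z \<in> c" "z \<in> d" for z
        using orbit[OF xy(1), of z] orbit[OF xy(2), of z] that unfolding xy(3,4) by simp
      then show ?thesis using cd(3) by blast
    qed
  qed
  then show ?thesis using U by (metis dvd_triv_left)
qed

section \<open>Coordinates seen from a corner of a core\<close>

text \<open>The position of \<open>Y\<close> relative to \<open>X\<close>, seen from the corner of the core of \<open>X\<close> whose outward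
  directions are the signs \<open>\<sigma>\<close>. The core is \<open>{X $ m - 1, X $ m}\<close> in each coordinate, so a reflection in
  its centre only changes the sign of \<open>Y $ m - X $ m\<close>.\<close>

definition rel :: "('n \<Rightarrow> int) \<Rightarrow> int ^ 'n \<Rightarrow> int ^ 'n \<Rightarrow> 'n::finite \<Rightarrow> int" where
  "rel \<sigma> X Y m = \<sigma> m * (Y $ m - X $ m)"

definition signs :: "('n \<Rightarrow> int) \<Rightarrow> bool" where
  "signs \<sigma> \<longleftrightarrow> (\<forall>m. \<sigma> m = 1 \<or> \<sigma> m = -1)"

text \<open>Passage to the neighbouring corner of the core along \<open>k\<close>.\<close>

definition flip :: "'n \<Rightarrow> ('n \<Rightarrow> int) \<Rightarrow> 'n \<Rightarrow> int" where
  "flip k \<sigma> = \<sigma>(k := - \<sigma> k)"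

lemma signs_flip [simp]: "signs \<sigma> \<Longrightarrow> signs (flip k \<sigma>)"
  unfolding signs_def flip_def by (metis fun_upd_apply minus_minus)

lemma flip_flip [simp]: "flip k (flip k \<sigma>) = \<sigma>"
  by (simp add: flip_def)

lemma rel_flip: "rel (flip k \<sigma>) X Y m = (if m = k then - rel \<sigma> X Y m else rel \<sigma> X Y m)"
  by (simp add: rel_def flip_def)

lemma rel_self [simp]: "rel \<sigma> X X m = 0"
  by (simp add: rel_def)

text \<open>The base point \<open>Z\<close> cancels and signs have absolute value 1, so distances
  between tiles can be measured from any corner.\<close>

lemma abs_rel_diff: "signs \<sigma> \<Longrightarrow> \<bar>rel \<sigma> Z X m - rel \<sigma> Z Y m\<bar> = \<bar>X $ m - Y $ m\<bar>"
  unfolding signs_def rel_def by (smt (verit, ccfv_SIG) mult_cancel_right1 mult_minus_left)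

section \<open>Tiles that are too close coincide\<close>

locale tiling =
  fixes T :: "(int ^ 'n::finite) set"
  assumes tiling: "integer_tiling T Upsilon"
begin

lemma tile_unique:
  assumes "X \<in> T" "Y \<in> T" "P - X \<in> Upsilon" "P - Y \<in> Upsilon"
  shows "X = Y"
proof (rule ccontr)
  assume "X \<noteq> Y"
  then have "translate X Upsilon \<inter> translate Y Upsilon = {}"
    using tiling assms(1,2) unfolding integer_tiling_def disjoint_family_on_def by blast
  moreover have "P \<in> translate X Upsilon" "P \<in> translate Y Upsilon"
    unfolding translate_def using assms(3,4) by (metis add.commute diff_add_cancel image_eqI)+
  ultimately show False by blast
qed

lemma tile_exists: "\<exists>X\<in>T. P - X \<in> Upsilon"
proof -
  have "P \<in> (\<Union>X\<in>T. translate X Upsilon)"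
    using tiling unfolding integer_tiling_def by simp
  then obtain X U where "X \<in> T" "U \<in> Upsilon" "P = X + U" unfolding translate_def by blast
  then show ?thesis by (intro bexI[of _ X]) simp_all
qed

text \<open>The arm of \<open>X\<close> along \<open>i\<close> meets the arm of \<open>Y\<close>
  along \<open>k\<close>.\<close>

lemma close_eq_two_abs:
  assumes XY: "X \<in> T" "Y \<in> T" and "\<bar>X $ i - Y $ i\<bar> \<le> 2" "\<bar>X $ k - Y $ k\<bar> \<le> 2" "i \<noteq> k"
    and close: "\<And>m. m \<noteq> i \<Longrightarrow> m \<noteq> k \<Longrightarrow> \<bar>X $ m - Y $ m\<bar> \<le> 1"
  shows "X = Y"
proof -
  \<comment> \<open>Cores \<open>{x - 1, x}\<close> and \<open>{y - 1, y}\<close> share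
    \<open>min x y\<close> if they differ by at most 1. At distance 2, \<open>X\<close> reaches into
    the core of \<open>Y\<close> along \<open>i\<close>, and \<open>Y\<close> into that of
    \<open>X\<close> along \<open>k\<close>.\<close>
  define P :: "int ^ 'n" where "P = (\<chi> m.
      if m = i \<and> X $ m = Y $ m + 2 then Y $ m else if m = i \<and> Y $ m = X $ m + 2 then X $ m + 1
      else if m = k \<and> X $ m = Y $ m + 2 then Y $ m + 1 else if m = k \<and> Y $ m = X $ m + 2 then X $ m
      else min (X $ m) (Y $ m))"
  have "(P - X) $ i \<in> {-2..1} \<and> (\<forall>m. m \<noteq> i \<longrightarrow> (P - X) $ m \<in> {-1, 0})"
  proof (intro conjI allI impI)
    show "(P - X) $ i \<in> {-2..1}" using assms by (auto simp: P_def)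
    show "(P - X) $ m \<in> {-1, 0}" if "m \<noteq> i" for m
      using assms(4) close[OF that] that by (cases "m = k") (auto simp: P_def)
  qed
  moreover have "(P - Y) $ k \<in> {-2..1} \<and> (\<forall>m. m \<noteq> k \<longrightarrow> (P - Y) $ m \<in> {-1, 0})"
  proof (intro conjI allI impI)
    show "(P - Y) $ k \<in> {-2..1}" using assms by (auto simp: P_def)
    show "(P - Y) $ m \<in> {-1, 0}" if "m \<noteq> k" for m
      using assms(3) close[of m] that by (cases "m = i") (auto simp: P_def)
  qed
  ultimately show ?thesis using tile_unique[OF XY, of P] unfolding mem_Upsilon_iff by blast
qed

text \<open>Along \<open>i\<close> a tile with its two arms is an interval of four points, so two
  such intervals meet at distance up to 3.\<close>

lemma close_eq_one_abs:
  assumes XY: "X \<in> T" "Y \<in> T" and "\<bar>X $ i - Y $ i\<bar> \<le> 3"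
    and close: "\<And>m. m \<noteq> i \<Longrightarrow> \<bar>X $ m - Y $ m\<bar> \<le> 1"
  shows "X = Y"
proof -
  define P :: "int ^ 'n" where "P = (\<chi> m.
      if m = i \<and> X $ m \<ge> Y $ m + 2 then X $ m - 2 else if m = i \<and> Y $ m \<ge> X $ m + 2 then Y $ m - 2
      else min (X $ m) (Y $ m))"
  have "(P - X) $ i \<in> {-2..1} \<and> (\<forall>m. m \<noteq> i \<longrightarrow> (P - X) $ m \<in> {-1, 0})"
  proof (intro conjI allI impI)
    show "(P - X) $ i \<in> {-2..1}" using assms by (auto simp: P_def)
    show "(P - X) $ m \<in> {-1, 0}" if "m \<noteq> i" for m
      using close[OF that] that by (auto simp: P_def)
  qed
  moreover have "(P - Y) $ i \<in> {-2..1} \<and> (\<forall>m. m \<noteq> i \<longrightarrow> (P - Y) $ m \<in> {-1, 0})"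
  proof (intro conjI allI impI)
    show "(P - Y) $ i \<in> {-2..1}" using assms by (auto simp: P_def)
    show "(P - Y) $ m \<in> {-1, 0}" if "m \<noteq> i" for m
      using close[OF that] that by (auto simp: P_def)
  qed
  ultimately show ?thesis using tile_unique[OF XY, of P] unfolding mem_Upsilon_iff by blast
qed

lemma close_eq_two:
  assumes "signs \<sigma>" "X \<in> T" "Y \<in> T" "i \<noteq> k"
    and "\<bar>rel \<sigma> Z X i - rel \<sigma> Z Y i\<bar> \<le> 2" "\<bar>rel \<sigma> Z X k - rel \<sigma> Z Y k\<bar> \<le> 2"
    and "\<And>m. m \<noteq> i \<Longrightarrow> m \<noteq> k \<Longrightarrow> \<bar>rel \<sigma> Z X m - rel \<sigma> Z Y m\<bar> \<le> 1"
  shows "X = Y"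
  using close_eq_two_abs[of X Y i k] assms by (simp add: abs_rel_diff)

lemma close_eq_one:
  assumes "signs \<sigma>" "X \<in> T" "Y \<in> T" "\<bar>rel \<sigma> Z X i - rel \<sigma> Z Y i\<bar> \<le> 3"
    and "\<And>m. m \<noteq> i \<Longrightarrow> \<bar>rel \<sigma> Z X m - rel \<sigma> Z Y m\<bar> \<le> 1"
  shows "X = Y"
  using close_eq_one_abs[of X Y i] assms by (simp add: abs_rel_diff)

text \<open>\<open>Y\<close> is the tile containing the point \<open>p m\<close> steps outwards from
  the corner in each direction \<open>m\<close>, and \<open>j\<close> the direction of its
  arm.\<close>

lemma cover:
  assumes "signs \<sigma>"
  obtains Y j where "Y \<in> T" "rel \<sigma> X Y j \<in> {p j - 1..p j + 2}"
    "\<And>m. m \<noteq> j \<Longrightarrow> rel \<sigma> X Y m = p m \<or> rel \<sigma> X Y m = p m + 1"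
proof -
  \<comment> \<open>The corner has coordinate \<open>X $ m\<close> for sign 1 and
    \<open>X $ m - 1\<close> for sign -1; with this shift the bounds on \<open>rel\<close> are the
    same for both signs.\<close>
  define P :: "int ^ 'n" where "P = (\<chi> m. X $ m + (if \<sigma> m = 1 then p m else - 1 - p m))"
  obtain Y j where Y: "Y \<in> T" "(P - Y) $ j \<in> {-2..1}" "\<And>m. m \<noteq> j \<Longrightarrow> (P - Y) $ m \<in> {-1, 0}"
    using tile_exists[of P] unfolding mem_Upsilon_iff by blast
  have s: "\<sigma> m = 1 \<or> \<sigma> m = -1" for m using assms by (simp add: signs_def)
  have "rel \<sigma> X Y j \<in> {p j - 1..p j + 2}" using Y(2) s[of j] by (auto simp: P_def rel_def)
  moreover have "rel \<sigma> X Y m = p m \<or> rel \<sigma> X Y m = p m + 1" if "m \<noteq> j" for m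
    using Y(3)[OF that] s[of m] by (auto simp: P_def rel_def)
  ultimately show ?thesis using that Y(1) by blast
qed

section \<open>Tiles covering the points two steps out in one direction\<close>

text \<open>The arm of \<open>Y\<close> in direction \<open>k\<close> then covers the point two steps outwards in direction \<open>i\<close>.\<close>

definition side :: "('n \<Rightarrow> int) \<Rightarrow> int ^ 'n \<Rightarrow> 'n \<Rightarrow> 'n \<Rightarrow> int ^ 'n \<Rightarrow> bool" where
  "side \<sigma> X i k Y \<longleftrightarrow> Y \<in> T \<and> i \<noteq> k \<and> rel \<sigma> X Y i = 3 \<and> rel \<sigma> X Y k = 2 \<and>
     (\<forall>m. m \<noteq> i \<longrightarrow> m \<noteq> k \<longrightarrow> rel \<sigma> X Y m = 0 \<or> rel \<sigma> X Y m = 1)"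

lemma sideD:
  assumes "side \<sigma> X i k Y"
  shows "Y \<in> T" "i \<noteq> k" "k \<noteq> i" "rel \<sigma> X Y i = 3" "rel \<sigma> X Y k = 2"
    "\<And>m. m \<noteq> i \<Longrightarrow> m \<noteq> k \<Longrightarrow> rel \<sigma> X Y m = 0 \<or> rel \<sigma> X Y m = 1"
  using assms by (auto simp: side_def)

text \<open>For the tile covering the point two steps out along \<open>i\<close>, all other offsets
  are so small that the closeness criteria would identify it with \<open>X\<close>.\<close>

lemma up_or_side_weak:
  assumes "signs \<sigma>" "X \<in> T"
  obtains (up) Y where "Y \<in> T" "rel \<sigma> X Y i = 4"
      "\<And>m. m \<noteq> i \<Longrightarrow> rel \<sigma> X Y m = 0 \<or> rel \<sigma> X Y m = 1"
    | (side) k Y where "side \<sigma> X i k Y"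
proof -
  obtain Y j where Y: "Y \<in> T" and
    j: "rel \<sigma> X Y j \<in> {(if j = i then 2 else 0) - 1..(if j = i then 2 else 0) + 2}" and
    o: "\<And>m. m \<noteq> j \<Longrightarrow> rel \<sigma> X Y m = (if m = i then 2 else 0) \<or>
         rel \<sigma> X Y m = (if m = i then 2 else 0) + 1"
    using cover[OF assms(1), of X "\<lambda>m. if m = i then 2 else 0"] by metis
  show ?thesis
  proof (cases "j = i")
    case True
    have oi: "rel \<sigma> X Y m = 0 \<or> rel \<sigma> X Y m = 1" if "m \<noteq> i" for m using o[of m] that True by simp
    have "rel \<sigma> X Y i = 4"
    proof (rule ccontr)
      assume "rel \<sigma> X Y i \<noteq> 4"
      then have "X = Y"
        using close_eq_one[OF assms Y, of X i] j oi True by force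
      then show False using j True by simp
    qed
    then show ?thesis using up Y oi by blast
  next
    case False
    have oj: "rel \<sigma> X Y m = 0 \<or> rel \<sigma> X Y m = 1" if "m \<noteq> i" "m \<noteq> j" for m
      using o[of m] that by simp
    have oi: "rel \<sigma> X Y i = 2 \<or> rel \<sigma> X Y i = 3" using o[of i] False by simp
    have j2: "rel \<sigma> X Y j = 2"
    proof (rule ccontr)
      assume "rel \<sigma> X Y j \<noteq> 2"
      then have "rel \<sigma> X Y j \<in> {-1..1}" using j False by auto
      then have "\<bar>rel \<sigma> X X m - rel \<sigma> X Y m\<bar> \<le> 1" if "m \<noteq> i" for m
        using oj[OF that] by (cases "m = j") auto
      then have "X = Y" using close_eq_one[OF assms Y, of X i] oi by auto
      then show False using oi by simp
    qed
    have "rel \<sigma> X Y i = 3"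
    proof (rule ccontr)
      assume "rel \<sigma> X Y i \<noteq> 3"
      then have "X = Y" using close_eq_two[OF assms Y, of i j X] oi j2 oj False by force
      then show False using oi by simp
    qed
    then show ?thesis using side[of j Y] Y j2 oj False by (simp add: side_def)
  qed
qed

text \<open>An offset 1 of the upper tile in a further direction \<open>m\<close> is refuted from
  the corner flipped in \<open>m\<close>: the tile found there is too close to \<open>Y\<close> and
  has a different offset.\<close>

lemma up_or_side:
  assumes "signs \<sigma>" "X \<in> T"
  shows "X + axis i (4 * \<sigma> i) \<in> T \<or> (\<exists>k Y. side \<sigma> X i k Y)"
proof (rule up_or_side_weak[OF assms, of i], goal_cases up side)
  case (up Y)
  have zero: "rel \<sigma> X Y m = 0" if m: "m \<noteq> i" for m
  proof (rule ccontr)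
    assume "rel \<sigma> X Y m \<noteq> 0"
    then have m1: "rel \<sigma> X Y m = 1" using up(3)[OF m] by simp
    have fs: "signs (flip m \<sigma>)" using assms by simp
    show False
    proof (rule up_or_side_weak[OF fs assms(2), of i], goal_cases up side)
      case up': (up Y')
      have r: "rel \<sigma> X Y' m = 0 \<or> rel \<sigma> X Y' m = -1" using up'(3)[OF m] by (auto simp: rel_flip)
      have "\<bar>rel \<sigma> X Y q - rel \<sigma> X Y' q\<bar> \<le> 1" if "q \<noteq> m" for q
        using up(2) up(3)[of q] up'(2) up'(3)[of q] that m by (cases "q = i") (auto simp: rel_flip)
      then have "Y = Y'" using close_eq_one[OF assms(1) up(1) up'(1), of X m] r m1 by auto
      then show False using r m1 by simp
    next
      case (side k Y')
      note s = sideD[OF side, unfolded rel_flip]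
      have i3: "rel \<sigma> X Y' i = 3" using s m by simp
      have "Y = Y'"
      proof (cases "k = m")
        case True
        have "\<bar>rel \<sigma> X Y q - rel \<sigma> X Y' q\<bar> \<le> 1" if "q \<noteq> m" for q
          using up(2) up(3)[of q] s(4) s(6)[of q] that m True by (cases "q = i") auto
        \<comment> \<open>Along \<open>m\<close> the offsets are 1 and -2: distance 3 is just within
          the bound.\<close>
        then show ?thesis
          using close_eq_one[OF assms(1) up(1) s(1), of X m] m1 s(5) True by auto
      next
        case False
        have "\<bar>rel \<sigma> X Y q - rel \<sigma> X Y' q\<bar> \<le> 1" if "q \<noteq> m" "q \<noteq> k" for q
          using up(2) up(3)[of q] s(4) s(6)[of q] that m by (cases "q = i") auto
        moreover have "\<bar>rel \<sigma> X Y m - rel \<sigma> X Y' m\<bar> \<le> 2" using m1 s(6)[of m] m False by auto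
        moreover have "\<bar>rel \<sigma> X Y k - rel \<sigma> X Y' k\<bar> \<le> 2"
          using up(3)[of k] s(2,5) False by auto
        ultimately show ?thesis
          using close_eq_two[OF assms(1) up(1) s(1), of m k X] False by blast
      qed
      then show False using i3 up(2) by simp
    qed
  qed
  have "Y = X + axis i (4 * \<sigma> i)"
  proof (rule iffD2[OF vec_eq_iff], rule allI)
    fix m
    have "\<sigma> m = 1 \<or> \<sigma> m = -1" using assms(1) by (simp add: signs_def)
    then show "Y $ m = (X + axis i (4 * \<sigma> i)) $ m"
      using zero[of m] up(2) by (cases "m = i") (auto simp: rel_def axis_def)
  qed
  then show ?thesis using up(1) by simp
next
  case (side k Y)
  then show ?thesis by blast
qed

text \<open>The two tiles would be 1 apart along \<open>i\<close>, 2 along \<open>k\<close> and at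
  most 1 elsewhere.\<close>

lemma not_up_and_side:
  assumes "signs \<sigma>" "side \<sigma> X i k Y"
  shows "X + axis i (4 * \<sigma> i) \<notin> T"
proof
  let ?Z = "X + axis i (4 * \<sigma> i)"
  note s = sideD[OF assms(2)]
  assume Z: "?Z \<in> T"
  have "\<sigma> i = 1 \<or> \<sigma> i = -1" using assms(1) by (simp add: signs_def)
  then have r: "rel \<sigma> X ?Z i = 4" "\<And>m. m \<noteq> i \<Longrightarrow> rel \<sigma> X ?Z m = 0"
    by (auto simp: rel_def axis_def)
  have "\<bar>rel \<sigma> X ?Z q - rel \<sigma> X Y q\<bar> \<le> 1" if "q \<noteq> k" for q
    using r(1) r(2)[of q] s(4) s(6)[of q] that by (cases "q = i") auto
  then have "?Z = Y" using close_eq_one[OF assms(1) Z s(1), of X k] r(2)[of k] s by auto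
  then show False using r(1) s(4) by simp
qed

text \<open>Two side tiles with different targets are at most 2 apart along these targets and at
  most 1 elsewhere.\<close>

lemma side_unique:
  assumes "signs \<sigma>" "side \<sigma> X i k Y" "side \<sigma> X i k' Y'"
  shows "k = k'"
proof (rule ccontr)
  assume ne: "k \<noteq> k'"
  note s = sideD[OF assms(2)] and s' = sideD[OF assms(3)]
  have "\<bar>rel \<sigma> X Y q - rel \<sigma> X Y' q\<bar> \<le> 1" if "q \<noteq> k" "q \<noteq> k'" for q
    using s(4) s(6)[of q] s'(4) s'(6)[of q] that by (cases "q = i") auto
  then have "Y = Y'"
    using close_eq_two[OF assms(1) s(1) s'(1) ne, of X] s(5) s(6)[of k'] s'(5) s'(6)[of k] s(3) s'(3) ne
    by auto
  then show False using s(5) s'(6)[of k] s(3) ne by auto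
qed

lemma side_asym:
  assumes "signs \<sigma>" "side \<sigma> X i k Y" "side \<sigma> X k i Y'"
  shows False
proof -
  note s = sideD[OF assms(2)] and s' = sideD[OF assms(3)]
  have "\<bar>rel \<sigma> X Y q - rel \<sigma> X Y' q\<bar> \<le> 1" if "q \<noteq> i" for q
    using s(5) s(6)[of q] s'(4) s'(6)[of q] that by (cases "q = k") auto
  then have "Y = Y'"
    using close_eq_one[OF assms(1) s(1) s'(1), of X i] s(4) s'(5) by auto
  then show False using s(4) s'(5) by simp
qed

section \<open>Tiles covering the points one step out in two directions\<close>

text \<open>The arm along each of the three directions covers the point one step out in the other
  two, so one tile serves three pairs.\<close>

definition triple :: "('n \<Rightarrow> int) \<Rightarrow> int ^ 'n \<Rightarrow> 'n \<Rightarrow> 'n \<Rightarrow> 'n \<Rightarrow> bool" where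
  "triple \<sigma> X i k l \<longleftrightarrow> i \<noteq> k \<and> k \<noteq> l \<and> l \<noteq> i \<and> (\<exists>Y\<in>T. rel \<sigma> X Y i = 2 \<and> rel \<sigma> X Y k = 2 \<and>
     rel \<sigma> X Y l = 2 \<and> (\<forall>m. m \<notin> {i, k, l} \<longrightarrow> rel \<sigma> X Y m = 0 \<or> rel \<sigma> X Y m = 1))"

lemma triple_swap: "triple \<sigma> X i k l \<Longrightarrow> triple \<sigma> X i l k"
  unfolding triple_def by (auto simp: insert_commute)

lemma triple_unique:
  assumes "signs \<sigma>" "triple \<sigma> X i k l" "triple \<sigma> X i k l'"
  shows "l = l'"
proof (rule ccontr)
  assume ne: "l \<noteq> l'"
  obtain Y where n: "i \<noteq> k" "k \<noteq> l" "l \<noteq> i" and Y: "Y \<in> T" "rel \<sigma> X Y i = 2" "rel \<sigma> X Y k = 2"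
     "rel \<sigma> X Y l = 2" "\<And>m. m \<notin> {i, k, l} \<Longrightarrow> rel \<sigma> X Y m = 0 \<or> rel \<sigma> X Y m = 1"
    using assms(2) unfolding triple_def by metis
  obtain Y' where n': "i \<noteq> k" "k \<noteq> l'" "l' \<noteq> i" and Y': "Y' \<in> T" "rel \<sigma> X Y' i = 2" "rel \<sigma> X Y' k = 2"
     "rel \<sigma> X Y' l' = 2" "\<And>m. m \<notin> {i, k, l'} \<Longrightarrow> rel \<sigma> X Y' m = 0 \<or> rel \<sigma> X Y' m = 1"
    using assms(3) unfolding triple_def by metis
  have "\<bar>rel \<sigma> X Y q - rel \<sigma> X Y' q\<bar> \<le> 1" if "q \<noteq> l" "q \<noteq> l'" for q
    using Y(2,3) Y(5)[of q] Y'(2,3) Y'(5)[of q] that by (cases "q = i"; cases "q = k") auto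
  moreover have "\<bar>rel \<sigma> X Y l - rel \<sigma> X Y' l\<bar> \<le> 2" using Y(4) Y'(5)[of l] n ne by auto
  moreover have "\<bar>rel \<sigma> X Y l' - rel \<sigma> X Y' l'\<bar> \<le> 2" using Y'(4) Y(5)[of l'] n' ne by auto
  ultimately have "Y = Y'" using close_eq_two[OF assms(1) Y(1) Y'(1) ne, of X] by blast
  then show False using Y(4) Y'(5)[of l] n ne by auto
qed

text \<open>The tiles would differ by more than 1 only along \<open>l\<close>, and there by at most
  2.\<close>

lemma triple_not_side:
  assumes "signs \<sigma>" "triple \<sigma> X i k l" "side \<sigma> X i k Y' \<or> side \<sigma> X k i Y'"
  shows False
proof -
  have aux: False if t: "triple \<sigma> X i k l" and side: "side \<sigma> X i k Y'" for i k
  proof -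
    note s = sideD[OF side]
    obtain Y where n: "i \<noteq> k" "k \<noteq> l" "l \<noteq> i" and Y: "Y \<in> T" "rel \<sigma> X Y i = 2" "rel \<sigma> X Y k = 2"
       "rel \<sigma> X Y l = 2" "\<And>m. m \<notin> {i, k, l} \<Longrightarrow> rel \<sigma> X Y m = 0 \<or> rel \<sigma> X Y m = 1"
      using t unfolding triple_def by metis
    have "\<bar>rel \<sigma> X Y q - rel \<sigma> X Y' q\<bar> \<le> 1" if "q \<noteq> l" for q
      using Y(2,3) Y(5)[of q] s(4,5) s(6)[of q] that by (cases "q = i"; cases "q = k") auto
    then have "Y = Y'"
      using close_eq_one[OF assms(1) Y(1) s(1), of X l] Y(4) s(6)[of l] n by auto
    then show False using Y(2) s(4) by simp
  qed
  have "triple \<sigma> X k i l" using assms(2) unfolding triple_def by (auto simp: insert_commute)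
  then show False using aux assms(2,3) by blast
qed

text \<open>Classifies the tile covering the point one step out along \<open>i\<close> and
  \<open>k\<close> by its arm direction \<open>j\<close>: a side tile if \<open>j\<close> is one of
  the two, a triple otherwise.\<close>

lemma pair_cases:
  assumes "signs \<sigma>" "X \<in> T" "i \<noteq> k"
  shows "(\<exists>Y. side \<sigma> X i k Y) \<or> (\<exists>Y. side \<sigma> X k i Y) \<or> (\<exists>l. triple \<sigma> X i k l)"
proof -
  let ?p = "\<lambda>m. if m = i \<or> m = k then 1 else 0 :: int"
  obtain Y j where Y: "Y \<in> T" and j: "rel \<sigma> X Y j \<in> {?p j - 1..?p j + 2}" and
    o: "\<And>m. m \<noteq> j \<Longrightarrow> rel \<sigma> X Y m = ?p m \<or> rel \<sigma> X Y m = ?p m + 1"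
    using cover[OF assms(1), of X ?p] by metis
  \<comment> \<open>The point leaves the core of \<open>X\<close> in two directions, an arm in only
    one.\<close>
  have ne: "Y \<noteq> X"
  proof
    assume "Y = X"
    then have "?p m = 0" if "m \<noteq> j" for m using o[OF that] by auto
    then show False using assms(3) by (metis zero_neq_one)
  qed
  have arm: "\<exists>Y. side \<sigma> X a b Y"
    if ab: "a \<noteq> b" "{a, b} = {i, k}" "j = a" for a b
  proof -
    have p: "?p m = (if m = a \<or> m = b then 1 else 0)" for m using ab by auto
    have ja: "rel \<sigma> X Y a \<in> {0..3}" using j p ab by simp
    have b: "rel \<sigma> X Y b = 1 \<or> rel \<sigma> X Y b = 2" using o[of b] p ab by simp
    have r: "rel \<sigma> X Y m = 0 \<or> rel \<sigma> X Y m = 1" if "m \<noteq> a" "m \<noteq> b" for m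
      using o[of m] p that ab by simp
    have a3: "rel \<sigma> X Y a = 3"
    proof (rule ccontr)
      assume "rel \<sigma> X Y a \<noteq> 3"
      then show False
        using close_eq_two[OF assms(1,2) Y ab(1), of X] ja b r ne by force
    qed
    have "rel \<sigma> X Y b = 2"
    proof (rule ccontr)
      assume "rel \<sigma> X Y b \<noteq> 2"
      then have "\<bar>rel \<sigma> X X m - rel \<sigma> X Y m\<bar> \<le> 1" if "m \<noteq> a" for m
        using r[OF that] b by (cases "m = b") auto
      then show False using close_eq_one[OF assms(1,2) Y, of X a] a3 ne by auto
    qed
    then show ?thesis using a3 r Y ab(1) unfolding side_def by blast
  qed
  consider "j = i" | "j = k" | "j \<noteq> i" "j \<noteq> k" by blast
  then show ?thesis
  proof cases
    case 1
    then show ?thesis using arm[of i k] assms(3) by blast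
  next
    case 2
    then show ?thesis using arm[of k i] assms(3) by blast
  next
    case 3
    have ri: "rel \<sigma> X Y i = 1 \<or> rel \<sigma> X Y i = 2" using o[of i] 3 by simp
    have rk: "rel \<sigma> X Y k = 1 \<or> rel \<sigma> X Y k = 2" using o[of k] 3 by simp
    have rj: "rel \<sigma> X Y j \<in> {-1..2}" using j 3 by simp
    have r: "rel \<sigma> X Y m = 0 \<or> rel \<sigma> X Y m = 1" if "m \<notin> {i, k, j}" for m
      using o[of m] that by simp
    \<comment> \<open>If one of the three offsets is at most 1 in absolute value, the other two
      directions serve as \<open>a\<close> and \<open>b\<close>; hence all three offsets are
      2.\<close>
    have close: "X = Y" if ab: "a \<noteq> b" "\<And>m. m \<in> {i, k, j} - {a, b} \<Longrightarrow> rel \<sigma> X Y m \<in> {-1..1}" for a b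
    proof (rule close_eq_two[OF assms(1,2) Y ab(1), of X])
      have all: "rel \<sigma> X Y m \<in> {-1..2}" for m
        using ri rk rj r[of m] by (cases "m = i"; cases "m = k"; cases "m = j") auto
      then show "\<bar>rel \<sigma> X X a - rel \<sigma> X Y a\<bar> \<le> 2" "\<bar>rel \<sigma> X X b - rel \<sigma> X Y b\<bar> \<le> 2"
        by (simp_all add: abs_le_iff, (smt (verit) all atLeastAtMost_iff)+)
      show "\<bar>rel \<sigma> X X m - rel \<sigma> X Y m\<bar> \<le> 1" if m: "m \<noteq> a" "m \<noteq> b" for m
        using ab(2)[of m] r[of m] m by (cases "m \<in> {i, k, j}") auto
    qed
    have "rel \<sigma> X Y i = 2" using close[of k j] ri 3 ne assms(3) by force
    moreover have "rel \<sigma> X Y k = 2" using close[of i j] rk 3 ne assms(3) by force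
    moreover have "rel \<sigma> X Y j = 2" using close[of i k] rj 3 ne assms(3) by force
    ultimately have "triple \<sigma> X i k j"
      using Y r 3 assms(3) unfolding triple_def by auto
    then show ?thesis by blast
  qed
qed

section \<open>Parity and the permutation of side directions\<close>

text \<open>Otherwise every pair of \<open>i\<close> with a direction other than \<open>k\<close>
  lies in a triple, and the third members pair off the remaining \<open>CARD('n) - 2\<close>
  directions, an odd number.\<close>

lemma side_into_of_side:
  assumes odd: "odd CARD('n)" and "signs \<sigma>" "X \<in> T" "side \<sigma> X i k Y"
  shows "\<exists>j Z. side \<sigma> X j i Z"
proof (rule ccontr)
  assume none: "\<not> ?thesis"
  let ?K = "UNIV - {i, k}"
  have t: "\<exists>l. triple \<sigma> X i m l" if "m \<in> ?K" for m
    using pair_cases[OF assms(2,3), of i m] none side_unique[OF assms(2,4)] that by blast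
  define f where "f m = (SOME l. triple \<sigma> X i m l)" for m
  have ft: "triple \<sigma> X i m (f m)" if "m \<in> ?K" for m
    unfolding f_def using t[OF that] by (rule someI_ex)
  have "even (card ?K)"
  proof (rule even_card_fixpoint_free_involution[where f = f])
    fix m assume m: "m \<in> ?K"
    have sw: "triple \<sigma> X i (f m) m" using ft[OF m] by (rule triple_swap)
    \<comment> \<open>The pair \<open>i\<close>, \<open>k\<close> is already served by the side
      tile.\<close>
    have "f m \<noteq> k" using triple_not_side[OF assms(2)] sw assms(4) by blast
    then have fm: "f m \<in> ?K" "f m \<noteq> m" using sw unfolding triple_def by auto
    show "f m \<in> ?K \<and> f m \<noteq> m \<and> f (f m) = m"
      using fm triple_unique[OF assms(2) ft[OF fm(1)] sw] by blast
  qed simp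
  moreover have "card ?K = CARD('n) - 2"
    using sideD(2)[OF assms(4)] by (simp add: card_Diff_subset)
  moreover have "CARD('n) \<ge> 2"
    using card_mono[of UNIV "{i, k}"] sideD(2)[OF assms(4)] by simp
  ultimately show False using odd by simp
qed

text \<open>The map \<open>f\<close> from a direction to its side target covers its finite domain
  \<open>D\<close>, hence permutes it; so \<open>k\<close> has a side tile of its own.\<close>

lemma side_target_not_up:
  assumes odd: "odd CARD('n)" and "signs \<sigma>" "X \<in> T" "side \<sigma> X i k Y"
  shows "X + axis k (4 * \<sigma> k) \<notin> T"
proof -
  define D where "D = {i. \<exists>k Y. side \<sigma> X i k Y}"
  define f where "f i = (SOME k. \<exists>Y. side \<sigma> X i k Y)" for i
  have f: "f i = k" if s: "side \<sigma> X i k Y" for i k Y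
  proof -
    have "\<exists>Y. side \<sigma> X i (f i) Y" unfolding f_def by (rule someI_ex) (use s in blast)
    then show ?thesis using side_unique[OF assms(2)] s by blast
  qed
  have "D \<subseteq> f ` D"
  proof
    fix j assume "j \<in> D"
    then obtain i Z where "side \<sigma> X i j Z"
      using side_into_of_side[OF odd assms(2,3)] unfolding D_def by blast
    then show "j \<in> f ` D" using f unfolding D_def by blast
  qed
  then have "f ` D = D" using card_image_le[of D f]
    by (metis card_seteq finite_class.finite_code finite_imageI finite_code)
  then have "k \<in> D" using f assms(4) unfolding D_def by blast
  then show ?thesis using not_up_and_side[OF assms(2)] unfolding D_def by blast
qed

text \<open>Along \<open>k\<close>, \<open>Y\<close> and \<open>Y'\<close> are 4 apart. Seen from
  \<open>Y\<close>, \<open>X\<close> is a side tile with target \<open>k\<close>, which forces a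
  side tile \<open>Z\<close> of \<open>Y\<close> in the direction of \<open>Y'\<close>.\<close>

lemma no_opposite_sides:
  assumes odd: "odd CARD('n)" and "signs \<sigma>" "X \<in> T" "side \<sigma> X i k Y" "side (flip k \<sigma>) X i k Y'"
  shows False
proof -
  note s = sideD[OF assms(4)] and s' = sideD[OF assms(5), unfolded rel_flip]
  have sg: "\<sigma> m = 1 \<or> \<sigma> m = -1" for m using assms(2) by (simp add: signs_def)
  define \<nu> where "\<nu> m = - \<sigma> m" for m
  have \<nu>: "signs \<nu>" using assms(2) unfolding signs_def \<nu>_def by auto
  have "rel \<nu> Y X m = rel \<sigma> X Y m" for m by (simp add: rel_def \<nu>_def algebra_simps)
  \<comment> \<open>The relation is symmetric: from \<open>Y\<close>, with all signs reversed, the side tile is \<open>X\<close>.\<close>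
  then have "side \<nu> Y i k X" using assms(3) assms(4) unfolding side_def by simp
  then have not_up: "Y + axis k (- 4 * \<sigma> k) \<notin> T"
    using side_target_not_up[OF odd \<nu> s(1)] unfolding \<nu>_def by fastforce
  \<comment> \<open>The signs are chosen such that a side tile of \<open>Y\<close> would overlap \<open>Y'\<close>.\<close>
  define \<tau> where "\<tau> m = (if m = k then - \<sigma> k else if Y' $ m < Y $ m then - 1 else 1)" for m
  have \<tau>: "signs \<tau>" using sg unfolding signs_def \<tau>_def by auto
  obtain l Z where Z: "side \<tau> Y k l Z"
    using up_or_side[OF \<tau> s(1), of k] not_up unfolding \<tau>_def by auto
  note z = sideD[OF Z]
  have k4: "rel \<tau> Y Y' k = 4"
    using s(5) s'(5) sg[of k] by (auto simp: rel_def \<tau>_def)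
  have r: "rel \<tau> Y Y' m = 0 \<or> rel \<tau> Y Y' m = 1" if "m \<noteq> k" for m
  proof (cases "m = i")
    case True
    then have "Y $ m = Y' $ m" using s(4) s'(4) sg[of i] that by (auto simp: rel_def)
    then show ?thesis by (simp add: rel_def)
  next
    case False
    then have "\<bar>Y $ m - Y' $ m\<bar> \<le> 1"
      using s(6)[OF False that] s'(6)[OF False that] abs_rel_diff[OF assms(2), of X Y m Y'] that
      by auto
    then show ?thesis using that by (auto simp: rel_def \<tau>_def)
  qed
  \<comment> \<open>\<open>Y'\<close> now sits like an upper tile of \<open>Y\<close> along
    \<open>k\<close>, up to offsets 1, and collides with the side tile \<open>Z\<close>.\<close>
  have "\<bar>rel \<tau> Y Z q - rel \<tau> Y Y' q\<bar> \<le> 1" if "q \<noteq> l" for q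
    using r[of q] k4 z(4) z(6)[of q] that by (cases "q = k") auto
  then have "Z = Y'"
    using close_eq_one[OF \<tau> z(1) s'(1), of Y l] r[of l] z(3,5) by fastforce
  then show False using k4 z(4) by simp
qed

text \<open>Descent over faces of the cube of corners, \<open>M\<close> being the set of free directions of the face: if
  the side direction \<open>k\<close> lies in \<open>M\<close>, flip \<open>k\<close> and keep free only those directions of \<open>M\<close> whose flip
  does not change the side tile \<open>Y\<close>.\<close>

lemma side_escapes:
  assumes odd: "odd CARD('n)" and X: "X \<in> T"
    and not_up: "X + axis i (4 * s) \<notin> T"
  shows "signs \<sigma> \<Longrightarrow> \<sigma> i = s \<Longrightarrow>
    \<exists>\<sigma>' k Y. signs \<sigma>' \<and> (\<forall>m. m \<notin> M \<longrightarrow> \<sigma>' m = \<sigma> m) \<and> side \<sigma>' X i k Y \<and> k \<notin> M"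
proof (induction "card M" arbitrary: M \<sigma> rule: less_induct)
  case less
  obtain k Y where kY: "side \<sigma> X i k Y"
    using up_or_side[OF less.prems(1) X, of i] not_up less.prems(2) by auto
  note y = sideD[OF kY]
  show ?case
  proof (cases "k \<in> M")
    case False
    then show ?thesis using kY less.prems(1) by blast
  next
    case True
    \<comment> \<open>Signs on \<open>M'\<close> do not affect \<open>Y\<close>, since
      \<open>X\<close> and \<open>Y\<close> agree there; \<open>k\<close> drops out, so the face
      shrinks.\<close>
    define M' where "M' = {m \<in> M. rel \<sigma> X Y m = 0}"
    have "k \<notin> M'" using y(5) unfolding M'_def by simp
    then have "M' \<subset> M" using True unfolding M'_def by blast
    then have "card M' < card M" by (intro psubset_card_mono) auto
    moreover have "flip k \<sigma> i = s" using less.prems(2) y(2) by (simp add: flip_def)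
    ultimately obtain \<sigma>' k' Y' where \<sigma>': "signs \<sigma>'" "\<And>m. m \<notin> M' \<Longrightarrow> \<sigma>' m = flip k \<sigma> m"
      and kY': "side \<sigma>' X i k' Y'" and "k' \<notin> M'"
      using less.hyps[of M' "flip k \<sigma>"] less.prems(1) by (metis signs_flip)
    have agree: "\<sigma>' m = \<sigma> m" if "m \<notin> M" for m
      using \<sigma>'(2)[of m] that True by (auto simp: M'_def flip_def)
    show ?thesis
    proof (cases "k' \<in> M")
      case False
      then show ?thesis using \<sigma>'(1) kY' agree by blast
    next
      case k'M: True
      \<comment> \<open>Undoing the flip of \<open>k\<close> makes \<open>Y\<close> a side tile
        again, so \<open>Y\<close> and \<open>Y'\<close> are compared from corners adjacent along
        \<open>k\<close>.\<close>
      define \<sigma>2 where "\<sigma>2 = flip k \<sigma>'"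
      have \<sigma>2: "signs \<sigma>2" "\<sigma>' = flip k \<sigma>2" using \<sigma>'(1) unfolding \<sigma>2_def by simp_all
      have same: "rel \<sigma>2 X Y m = rel \<sigma> X Y m" for m
      proof (cases "m \<in> M'")
        case True
        then have "Y $ m = X $ m"
          using less.prems(1) unfolding M'_def rel_def signs_def
          by (auto simp: mult_eq_0_iff) (metis zero_neq_neg_one zero_neq_one)
        then show ?thesis by (simp add: rel_def)
      next
        case False
        then have "\<sigma>2 m = \<sigma> m" using \<sigma>'(2)[OF False] by (auto simp: \<sigma>2_def flip_def)
        then show ?thesis by (simp add: rel_def)
      qed
      then have kY2: "side \<sigma>2 X i k Y" using kY unfolding side_def by simp
      note y2 = sideD[OF kY2] and y' = sideD[OF kY'[unfolded \<sigma>2(2)], unfolded rel_flip]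
      have "k' \<noteq> k" using no_opposite_sides[OF odd \<sigma>2(1) X kY2] kY' \<sigma>2(2) by metis
      \<comment> \<open>A target in \<open>M\<close> outside \<open>M'\<close> has nonzero offset in
        \<open>Y\<close>, hence 1, next to the 2 of \<open>Y'\<close>; this leaves \<open>Y\<close>
        and \<open>Y'\<close> too close.\<close>
      have k'1: "rel \<sigma>2 X Y k' = 1"
        using \<open>k' \<notin> M'\<close> k'M same y2(6)[of k'] y'(3) \<open>k' \<noteq> k\<close> by (auto simp: M'_def)
      have "\<bar>rel \<sigma>2 X Y q - rel \<sigma>2 X Y' q\<bar> \<le> 1" if "q \<noteq> k" for q
        using k'1 y2(4) y2(6)[of q] y'(4,5) y'(6)[of q] that \<open>k' \<noteq> k\<close>
        by (cases "q = i"; cases "q = k'") auto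
      moreover have k0: "rel \<sigma>2 X Y' k = 0 \<or> rel \<sigma>2 X Y' k = -1"
        using y'(6)[of k] y2(3) \<open>k' \<noteq> k\<close> by auto
      ultimately have "Y = Y'"
        using close_eq_one[OF \<sigma>2(1) y(1) y'(1), of X k] y2(5) by auto
      then have False using k0 y2(5) by auto
      then show ?thesis ..
    qed
  qed
qed

section \<open>Periodicity and counting modulo 4\<close>

text \<open>With all directions free, the descent would yield a side target outside
  \<open>UNIV\<close>.\<close>

lemma period_axis:
  assumes odd: "odd CARD('n)" and X: "X \<in> T" and s: "s = 1 \<or> s = -1"
  shows "X + axis i (4 * s) \<in> T"
proof (rule ccontr)
  assume "X + axis i (4 * s) \<notin> T"
  then show False
    using side_escapes[OF odd X, of i s "\<lambda>_. s" UNIV] s by (auto simp: signs_def)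
qed

lemma period:
  assumes odd: "odd CARD('n)" and X: "X \<in> T"
  shows "X + (\<chi> m. 4 * v m) \<in> T"
proof -
  have nat_step: "X + axis i (4 * s * int c) \<in> T"
    if "X \<in> T" "s = 1 \<or> s = -1" for X i s c
  proof (induction c)
    case 0
    have "X + axis i (4 * s * int 0) = X" by (simp add: vec_eq_iff axis_def)
    then show ?case using that(1) by metis
  next
    case (Suc c)
    have "X + axis i (4 * s * int (Suc c)) = X + axis i (4 * s * int c) + axis i (4 * s)"
      by (simp add: vec_eq_iff axis_def algebra_simps)
    then show ?case using period_axis[OF odd Suc that(2)] by metis
  qed
  have step: "X + axis i (4 * c) \<in> T" if "X \<in> T" for X i c
  proof (cases "c \<ge> 0")
    case True
    then show ?thesis using nat_step[OF that, of 1 i "nat c"] by simp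
  next
    case False
    then show ?thesis using nat_step[OF that, of "-1" i "nat (- c)"] by simp
  qed
  have "X + (\<chi> m. if m \<in> S then 4 * v m else 0) \<in> T" if "finite S" for S
    using that
  proof (induction S)
    case empty
    have eq: "X + (\<chi> m. if m \<in> {} then 4 * v m else 0) = X" by (simp add: vec_eq_iff)
    show ?case unfolding eq by (rule X)
  next
    case (insert a S)
    have eq: "X + (\<chi> m. if m \<in> insert a S then 4 * v m else 0) =
        X + (\<chi> m. if m \<in> S then 4 * v m else 0) + axis a (4 * v a)"
    proof (rule iffD2[OF vec_eq_iff], rule allI)
      fix m
      show "(X + (\<chi> m. if m \<in> insert a S then 4 * v m else 0)) $ m =
          (X + (\<chi> m. if m \<in> S then 4 * v m else 0) + axis a (4 * v a)) $ m"
        using insert.hyps by (cases "m = a"; cases "m \<in> S") (simp_all add: axis_def)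
    qed
    show ?case unfolding eq by (rule step[OF insert.IH])
  qed
  from this[of UNIV] show ?thesis by simp
qed

end

lemma card_vec_box:
  "card {P :: 'a ^ 'n::finite. \<forall>m. P $ m \<in> A} = card A ^ CARD('n)"
proof -
  have "bij_betw vec_nth {P :: 'a ^ 'n. \<forall>m. P $ m \<in> A} (UNIV \<rightarrow>\<^sub>E A)"
    by (rule bij_betw_byWitness[where f' = vec_lambda]) auto
  then have "card {P :: 'a ^ 'n. \<forall>m. P $ m \<in> A} = card ((UNIV :: 'n set) \<rightarrow>\<^sub>E A)"
    by (rule bij_betw_same_card)
  then show ?thesis by (simp add: card_PiE)
qed

text \<open>A point of the tile is a core point with no coordinate or exactly one pushed outwards,
  from 0 to 1 or from -1 to -2; the \<open>option\<close> records which.\<close>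

lemma card_Upsilon: "card (Upsilon :: (int ^ 'n::finite) set) = 2 ^ CARD('n) * (CARD('n) + 1)"
proof -
  let ?Q = "{P :: int ^ 'n. \<forall>m. P $ m \<in> {-1, 0}}"
  define g :: "(int ^ 'n) \<times> 'n option \<Rightarrow> int ^ 'n" where
    "g = (\<lambda>(c, oi). \<chi> m. if oi = Some m then (if c $ m = 0 then 1 else - 2) else c $ m)"
  define h :: "int ^ 'n \<Rightarrow> (int ^ 'n) \<times> 'n option" where
    "h U = (\<chi> m. if U $ m \<ge> 0 then 0 else - 1,
            if \<exists>m. U $ m \<notin> {-1, 0} then Some (THE m. U $ m \<notin> {-1, 0}) else None)" for U
  have "bij_betw g (?Q \<times> UNIV) Upsilon"
  proof (rule bij_betw_byWitness[where f' = h])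
    show "\<forall>a\<in>?Q \<times> UNIV. h (g a) = a"
    proof clarify
      fix c :: "int ^ 'n" and oi :: "'n option"
      assume c: "\<forall>m. c $ m \<in> {-1, 0}"
      have ex: "g (c, oi) $ m \<notin> {-1, 0} \<longleftrightarrow> oi = Some m" for m
        using c by (simp add: g_def)
      have "snd (h (g (c, oi))) = oi" unfolding h_def snd_conv ex by (cases oi) simp_all
      moreover have "fst (h (g (c, oi))) = c"
        using c by (simp add: h_def g_def vec_eq_iff) (smt (verit))
      ultimately show "h (g (c, oi)) = (c, oi)" by (metis prod.collapse)
    qed
    show "\<forall>U\<in>Upsilon. g (h U) = U"
    proof
      fix U :: "int ^ 'n" assume "U \<in> Upsilon"
      then obtain j where j: "U $ j \<in> {-2..1}" "\<And>m. m \<noteq> j \<Longrightarrow> U $ m \<in> {-1, 0}"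
        unfolding mem_Upsilon_iff by blast
      show "g (h U) = U"
      proof (cases "U $ j \<in> {-1, 0}")
        case True
        then have U: "U $ m = - 1 \<or> U $ m = 0" for m using j(2)[of m] by (cases "m = j") auto
        then have "h U = (\<chi> m. if U $ m \<ge> 0 then 0 else - 1, None)" by (simp add: h_def)
        then show ?thesis using U by (simp add: g_def vec_eq_iff) (smt (verit))
      next
        case False
        then have "(THE m. U $ m \<notin> {-1, 0}) = j" using j(2) by blast
        then have "h U = (\<chi> m. if U $ m \<ge> 0 then 0 else - 1, Some j)"
          using False unfolding h_def by auto
        then have g: "g (h U) $ m = (if m = j then if U $ m \<ge> 0 then 1 else - 2
            else if U $ m \<ge> 0 then 0 else - 1)" for m by (simp add: g_def)
        have "g (h U) $ m = U $ m" for m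
          unfolding g using False j(1) j(2)[of m] by (cases "m = j") auto
        then show ?thesis by (simp add: vec_eq_iff)
      qed
    qed
    show "g ` (?Q \<times> UNIV) \<subseteq> Upsilon"
    proof clarify
      fix c :: "int ^ 'n" and oi :: "'n option"
      assume c: "\<forall>m. c $ m \<in> {-1, 0}"
      obtain j where "oi = None \<or> oi = Some j" by (cases oi) auto
      then show "g (c, oi) \<in> Upsilon"
        unfolding mem_Upsilon_iff using c by (intro exI[of _ j]) (force simp: g_def)
    qed
    show "h ` Upsilon \<subseteq> ?Q \<times> UNIV" by (auto simp: h_def)
  qed
  then have "card (?Q \<times> (UNIV :: 'n option set)) = card (Upsilon :: (int ^ 'n) set)"
    by (rule bij_betw_same_card)
  then show ?thesis
    unfolding card_cartesian_product card_vec_box by (simp add: card_UNIV_option flip: numeral_2_eq_2)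
qed

context tiling
begin

text \<open>By periodicity the tiling descends to residues modulo 4, where tile and offset still
  determine the point uniquely.\<close>

lemma card_fundamental_domain:
  assumes odd: "odd CARD('n)"
  shows "card {X \<in> T. \<forall>m. X $ m \<in> {0..3}} * card (Upsilon :: (int ^ 'n) set) = 4 ^ CARD('n)"
proof -
  let ?C = "{X \<in> T. \<forall>m. X $ m \<in> {0..3}}" and ?B = "{P :: int ^ 'n. \<forall>m. P $ m \<in> {0..3}}"
  define r :: "int ^ 'n \<Rightarrow> int ^ 'n" where "r P = (\<chi> m. P $ m mod 4)" for P
  have r_id: "r X = X" if "X \<in> ?B" for X
    using that by (force simp: r_def vec_eq_iff intro: mod_pos_pos_trivial)
  have shift: "\<exists>v. Q = P + (\<chi> m. 4 * v m)" if "r P = r Q" for P Q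
  proof -
    have "4 dvd Q $ m - P $ m" for m
      using that by (metis mod_eq_dvd_iff r_def vec_lambda_beta)
    then have "\<exists>v. \<forall>m. Q $ m - P $ m = 4 * v m" unfolding dvd_def by metis
    then show ?thesis by (auto simp: vec_eq_iff algebra_simps)
  qed
  have "bij_betw (\<lambda>(X, U). r (X + U)) (?C \<times> Upsilon) ?B"
  proof (rule bij_betwI')
    fix a b assume "a \<in> ?C \<times> (Upsilon :: (int ^ 'n) set)" "b \<in> ?C \<times> (Upsilon :: (int ^ 'n) set)"
    then obtain X U Y V where ab: "a = (X, U)" "b = (Y, V)" and
      XY: "X \<in> T" "Y \<in> T" "X \<in> ?B" "Y \<in> ?B" and UV: "U \<in> Upsilon" "V \<in> Upsilon" by auto
    have "X = Y \<and> U = V" if eq: "r (X + U) = r (Y + V)"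
    proof -
      obtain v where v: "Y + V = X + U + (\<chi> m. 4 * v m)" using shift[OF eq] by blast
      let ?X = "X + (\<chi> m. 4 * v m)"
      have "Y + V - ?X = U" using v by (simp add: algebra_simps)
      moreover have "Y + V - Y = V" by simp
      \<comment> \<open>The shifted \<open>X\<close> is again a tile and contains
        \<open>Y + V\<close>.\<close>
      ultimately have XY': "?X = Y"
        using tile_unique[OF period[OF odd XY(1)] XY(2), of "Y + V" v] UV by metis
      have "r ?X = r X" by (simp add: r_def vec_eq_iff)
      then have "X = Y" using XY' r_id XY(3,4) by metis
      moreover have "U = V" using v XY' by (simp add: algebra_simps)
      ultimately show ?thesis by simp
    qed
    then show "((case a of (X, U) \<Rightarrow> r (X + U)) = (case b of (X, U) \<Rightarrow> r (X + U))) = (a = b)"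
      using ab by auto
  next
    fix a assume "a \<in> ?C \<times> (Upsilon :: (int ^ 'n) set)"
    then show "(case a of (X, U) \<Rightarrow> r (X + U)) \<in> ?B" by (auto simp: r_def)
  next
    fix P assume P: "P \<in> ?B"
    obtain X where X: "X \<in> T" "P - X \<in> Upsilon" using tile_exists by blast
    define v where "v m = - (X $ m div 4)" for m
    have rX: "r X = X + (\<chi> m. 4 * v m)"
      by (simp add: r_def v_def vec_eq_iff minus_div_mult_eq_mod[symmetric])
    have "r X \<in> T" using period[OF odd X(1), where v = v] unfolding rX[symmetric] .
    then have "r X \<in> ?C" by (auto simp: r_def)
    moreover have "r (r X + (P - X)) = P"
      unfolding rX using r_id[OF P] by (simp add: r_def vec_eq_iff)
    ultimately show "\<exists>a\<in>?C \<times> Upsilon. P = (case a of (X, U) \<Rightarrow> r (X + U))"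
      using X(2) by (intro bexI[of _ "(r X, P - X)"]) auto
  qed
  then have "card (?C \<times> (Upsilon :: (int ^ 'n) set)) = card ?B" by (rule bij_betw_same_card)
  then show ?thesis by (simp add: card_cartesian_product card_vec_box del: atLeastAtMost_iff)
qed

end

theorem theorem2:
  fixes T :: "(int ^ 'n::finite) set"
  assumes "odd CARD('n)"
    and "integer_tiling T Upsilon"
  shows "\<exists>t::nat. t > 0 \<and> CARD('n) = 2 ^ t - 1"
proof -
  interpret tiling T using assms(2) by unfold_locales
  have "CARD('n) + 1 dvd 4 ^ CARD('n)"
    using card_fundamental_domain[OF assms(1)] unfolding card_Upsilon
    by (metis (no_types, lifting) dvd_def mult.commute mult.left_commute)
  also have "(4 :: nat) ^ CARD('n) = 2 ^ (2 * CARD('n))" by (simp add: power_mult)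
  \<comment> \<open>A divisor of a power of the prime 2 is itself a power of 2.\<close>
  finally obtain t where t: "CARD('n) + 1 = 2 ^ t"
    using divides_primepow_nat[OF two_is_prime_nat] by blast
  moreover have "t > 0" using t by (cases t) auto
  ultimately show ?thesis by (metis add_diff_cancel_right')
qed

end
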